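(* For all integers $n,k\ge0$ with $n\ge k$ and every nonnegative integer $r$, \[ S_{2,\lambda}^{(r,Y)}(n+r,k+r)=\sum_{m=0}^{n-k}\binom{m+k}{m}\binom{r}{m}m!\,S_{2,\lambda}^{Y}(n,m+k). \]
   Context: Let $\lambda$ be a nonzero real number. Define $(x)_{0,\lambda}=1$ and $(x)_{n,\lambda}=x(x-\lambda)\cdots(x-(n-1)\lambda)$ for $n\ge1$, and the degenerate exponential $e_{\lambda}^{x}(t)=(1+\lambda t)^{x/\lambda}=\sum_{n\ge0}(x)_{n,\lambda}\frac{t^n}{n!}$. Let $Y$ be a random variable whose moment generating function exists in a neighborhood of the origin, let $(Y_j)_{j\ge1}$ be mutually independent copies of $Y$, and set $S_0=0$, $S_k=Y_1+\cdots+Y_k$ for $k\ge1$. The probabilistic degenerate Stirling numbers of the second kind associated with $Y$ are defined by $\frac{1}{k!}\big(E[e_{\lambda}^{Y}(t)]-1\big)^{k}=\sum_{n=k}^{\infty}S_{2,\lambda}^{Y}(n,k)\frac{t^n}{n!}$. For $r$ a nonnegative integer, the probabilistic degenerate $r$-Stirling numbers of the second kind associated with $Y$ are defined by \[ \frac{1}{k!}\Big(E\big[e_{\lambda}^{Y}(t)\big]-1\Big)^{k}E\big[e_{\lambda}^{S_r}(t)\big]=\sum_{n=k}^{\infty}S_{2,\lambda}^{(r,Y)}(n+r,k+r)\frac{t^n}{n!},\quad(k\ge0). \] *)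

theory Defs
  imports "HOL-Probability.Probability"
begin

definition degenerate_falling :: "real \<Rightarrow> real \<Rightarrow> nat \<Rightarrow> real" where
  "degenerate_falling lam x n = (\<Prod>i<n. x - real i * lam)"

definition degenerate_exp :: "real \<Rightarrow> real \<Rightarrow> real \<Rightarrow> real" where
  "degenerate_exp lam x t = (1 + lam * t) powr (x / lam)"

lemma degenerate_exp_sums:
  assumes "lam \<noteq> 0" and "\<bar>lam * t\<bar> < 1"
  shows "(\<lambda>n. degenerate_falling lam x n * t ^ n / fact n) sums degenerate_exp lam x t"
proof -
  have *: "((x / lam) gchoose n) * (lam * t) ^ n = degenerate_falling lam x n * t ^ n / fact n" for n
  proof -
    have "(\<Prod>i<n. x - real i * lam) = (\<Prod>i<n. (x / lam - real i) * lam)"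
      using assms(1) by (intro prod.cong) (auto simp: field_simps)
    also have "\<dots> = (\<Prod>i<n. x / lam - real i) * lam ^ n"
      by (simp add: prod.distrib)
    finally show ?thesis
      by (simp add: gbinomial_prod_rev degenerate_falling_def power_mult_distrib atLeast0LessThan)
  qed
  show ?thesis
    using gen_binomial_real[OF assms(2), of "x / lam"]
    unfolding * degenerate_exp_def by simp
qed

definition mgf_exists_near_0 :: "'a measure \<Rightarrow> ('a \<Rightarrow> real) \<Rightarrow> bool" where
  "mgf_exists_near_0 M Y \<longleftrightarrow>
     (\<exists>\<delta>>0. \<forall>s. \<bar>s\<bar> < \<delta> \<longrightarrow> integrable M (\<lambda>\<omega>. exp (s * Y \<omega>)))"

text \<open>The copies are indexed from 1; the value of \<open>Ys\<close> at 0 is irrelevant.\<close>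

definition independent_copies :: "'a measure \<Rightarrow> ('a \<Rightarrow> real) \<Rightarrow> (nat \<Rightarrow> 'a \<Rightarrow> real) \<Rightarrow> bool" where
  "independent_copies M Y Ys \<longleftrightarrow>
     prob_space.indep_vars M (\<lambda>_. borel) Ys {1..} \<and>
     (\<forall>j\<ge>1. distr M borel (Ys j) = distr M borel Y)"

definition partial_sum :: "(nat \<Rightarrow> 'a \<Rightarrow> real) \<Rightarrow> nat \<Rightarrow> 'a \<Rightarrow> real" where
  "partial_sum Ys k \<omega> = (\<Sum>j = 1..k. Ys j \<omega>)"

text \<open>
  \<open>f t = (\<Sum>n\<ge>k. a n * t ^ n / n!)\<close> for all real \<open>t\<close> near 0. The coefficients below \<open>k\<close>,
  which do not occur in this series, are fixed to be 0, so that \<open>a\<close> is unique.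
\<close>

definition has_egf_from :: "nat \<Rightarrow> (real \<Rightarrow> real) \<Rightarrow> (nat \<Rightarrow> real) \<Rightarrow> bool" where
  "has_egf_from k f a \<longleftrightarrow>
     (\<forall>n<k. a n = 0) \<and>
     (\<forall>\<^sub>F t in nhds 0. (\<lambda>n. a n * t ^ n / fact n) sums f t)"

definition prob_degenerate_stirling2 ::
  "'a measure \<Rightarrow> real \<Rightarrow> ('a \<Rightarrow> real) \<Rightarrow> nat \<Rightarrow> nat \<Rightarrow> real" where
  "prob_degenerate_stirling2 M lam Y n k =
     (THE a. has_egf_from k
        (\<lambda>t. 1 / fact k * (integral\<^sup>L M (\<lambda>\<omega>. degenerate_exp lam (Y \<omega>) t) - 1) ^ k) a) n"

text \<open>
  The generating function defines the number with arguments \<open>n + r\<close> and \<open>k + r\<close>, whence the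
  index shift below; the values for \<open>N < r\<close> or \<open>K < r\<close> carry no meaning.
\<close>

definition prob_degenerate_r_stirling2 ::
  "'a measure \<Rightarrow> real \<Rightarrow> ('a \<Rightarrow> real) \<Rightarrow> (nat \<Rightarrow> 'a \<Rightarrow> real) \<Rightarrow> nat \<Rightarrow> nat \<Rightarrow> nat \<Rightarrow> real" where
  "prob_degenerate_r_stirling2 M lam Y Ys r N K =
     (let k = K - r in
      (THE a. has_egf_from k
        (\<lambda>t. 1 / fact k * (integral\<^sup>L M (\<lambda>\<omega>. degenerate_exp lam (Y \<omega>) t) - 1) ^ k
             * integral\<^sup>L M (\<lambda>\<omega>. degenerate_exp lam (partial_sum Ys r \<omega>) t)) a) (N - r))"

end

theory Submission
  imports Defs "HOL-Complex_Analysis.Laurent_Convergence"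
begin

text \<open>
  Put \<open>F t = E[e\<^sub>\<lambda>\<^sup>Y(t)]\<close>. Independence gives \<open>E[e\<^sub>\<lambda>\<^sup>S(t)] = F t ^ r\<close> for the \<open>r\<close>-th partial sum,
  and expanding \<open>F ^ r = (1 + (F - 1)) ^ r\<close> by the binomial theorem turns the generating function
  \<open>(F - 1) ^ k / k! * F ^ r\<close> into a combination of the generating functions
  \<open>(F - 1) ^ (m + k) / (m + k)!\<close>. Comparing coefficients is legitimate because \<open>F\<close> is a convergent
  power series near 0: the degenerate exponential series is dominated by the one with parameters
  \<open>- \<bar>\<lambda>\<bar>\<close>, \<open>\<bar>Y\<bar>\<close>, \<open>\<bar>t\<bar>\<close>, whose sum is \<open>exp (s * \<bar>Y\<bar>)\<close> with \<open>s\<close> tending to 0 as \<open>t\<close> does.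
\<close>

section \<open>Uniqueness of power series and of exponential generating functions\<close>

text \<open>Otherwise, dividing by \<open>x ^ n\<close> with \<open>n\<close> the subdegree gives a
  function continuous at 0 that vanishes away from 0 but takes the nonzero leading coefficient at
  0.\<close>

lemma has_fps_expansion_zero_imp_eq_0:
  fixes F :: "'a :: {banach, real_normed_field} fps"
  assumes "(\<lambda>_. 0) has_fps_expansion F"
  shows "F = 0"
proof (rule ccontr)
  assume "F \<noteq> 0"
  define n where "n = subdegree F"
  define g where "g = (\<lambda>x::'a. if x = 0 then fps_nth F n else 0 / x ^ n)"
  have "g has_fps_expansion fps_shift n F"
    unfolding g_def by (rule has_fps_expansion_shift) (use assms in \<open>auto simp: n_def\<close>)
  then have "(g \<longlongrightarrow> g 0) (at 0)"
    using has_fps_expansion_imp_continuous[of g _ UNIV] by (simp add: continuous_at)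
  moreover have "(g \<longlongrightarrow> 0) (at 0)"
    by (rule tendsto_eventually) (auto simp: g_def eventually_at_filter)
  ultimately have "g 0 = 0"
    by (rule LIM_unique)
  with \<open>F \<noteq> 0\<close> show False
    by (simp add: g_def n_def)
qed

lemma has_fps_expansion_unique:
  fixes F G :: "'a :: {banach, real_normed_field} fps"
  assumes "f has_fps_expansion F" "f has_fps_expansion G"
  shows "F = G"
  using has_fps_expansion_diff[OF assms] has_fps_expansion_zero_imp_eq_0[of "F - G"] by simp

lemma has_fps_expansion_imp_sums:
  fixes F :: "'a :: {banach, real_normed_field} fps"
  assumes "f has_fps_expansion F"
  shows "\<forall>\<^sub>F x in nhds 0. (\<lambda>n. fps_nth F n * x ^ n) sums f x"
proof -
  have "\<forall>\<^sub>F x in nhds 0. x \<in> eball 0 (fps_conv_radius F)"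
    using assms by (intro eventually_nhds_in_open) (auto simp: has_fps_expansion_def zero_ereal_def)
  moreover have "\<forall>\<^sub>F x in nhds 0. eval_fps F x = f x"
    using assms by (simp add: has_fps_expansion_def)
  ultimately show ?thesis
  proof eventually_elim
    case (elim x)
    then show ?case
      using sums_eval_fps[of x F] by simp
  qed
qed

text \<open>Absorbing the factorials into the coefficients makes the algebra of
  \<open>has_fps_expansion\<close> available for generating functions.\<close>

lemma has_egf_from_iff_has_fps_expansion:
  "has_egf_from k f a \<longleftrightarrow>
     (\<forall>n<k. a n = 0) \<and> f has_fps_expansion Abs_fps (\<lambda>n. a n / fact n)"
  using has_fps_expansionI[where f = f and F = "Abs_fps (\<lambda>n. a n / fact n)"]
    has_fps_expansion_imp_sums[where f = f and F = "Abs_fps (\<lambda>n. a n / fact n)"]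
  unfolding has_egf_from_def by auto

text \<open>Evaluates the definite descriptions that define both kinds of Stirling numbers.\<close>

lemma the_has_egf_from:
  assumes "f has_fps_expansion F" "\<And>n. n < k \<Longrightarrow> fps_nth F n = 0"
  shows "(THE a. has_egf_from k f a) = (\<lambda>n. fact n * fps_nth F n)"
proof (rule the_equality)
  show "has_egf_from k f (\<lambda>n. fact n * fps_nth F n)"
    using assms by (simp add: has_egf_from_iff_has_fps_expansion fps_nth_inverse)
next
  fix a assume "has_egf_from k f a"
  then have "Abs_fps (\<lambda>n. a n / fact n) = F"
    using assms(1) has_fps_expansion_unique by (auto simp: has_egf_from_iff_has_fps_expansion)
  then show "a = (\<lambda>n. fact n * fps_nth F n)"
    by (auto simp: fun_eq_iff)
qed

section \<open>Bounds and integrability for degenerate exponentials\<close>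

text \<open>The factors on the right are \<open>\<bar>x\<bar> + i * \<bar>lam\<bar>\<close>, so this
  is the triangle inequality factor by factor.\<close>

lemma abs_degenerate_falling_le:
  "\<bar>degenerate_falling lam x n\<bar> \<le> degenerate_falling (- \<bar>lam\<bar>) \<bar>x\<bar> n"
  unfolding degenerate_falling_def abs_prod
proof (rule prod_mono)
  fix i
  show "0 \<le> \<bar>x - real i * lam\<bar> \<and> \<bar>x - real i * lam\<bar> \<le> \<bar>x\<bar> - real i * - \<bar>lam\<bar>"
    using abs_triangle_ineq4[of x "real i * lam"] by (simp add: abs_mult)
qed

text \<open>This form shows multiplicativity in \<open>x\<close> and links expectations to the
  moment generating function at \<open>ln (1 + lam * t) / lam\<close>.\<close>

lemma degenerate_exp_eq_exp:
  assumes "1 + lam * t > 0"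
  shows "degenerate_exp lam x t = exp (ln (1 + lam * t) / lam * x)"
  using assms by (simp add: degenerate_exp_def powr_def)

lemma degenerate_exp_sum:
  assumes "1 + lam * t > 0" "finite I"
  shows "degenerate_exp lam (\<Sum>i\<in>I. x i) t = (\<Prod>i\<in>I. degenerate_exp lam (x i) t)"
  using assms by (simp add: degenerate_exp_eq_exp sum_distrib_left exp_sum)

lemma borel_measurable_degenerate_exp [measurable]:
  "(\<lambda>x. degenerate_exp lam x t) \<in> borel_measurable borel"
  unfolding degenerate_exp_def by measurable

lemma borel_measurable_degenerate_falling [measurable]:
  "(\<lambda>x. degenerate_falling lam x n) \<in> borel_measurable borel"
  unfolding degenerate_falling_def by measurable

text \<open>The integrand always equals one of \<open>exp (s * Y \<omega>)\<close> and
  \<open>exp (- s * Y \<omega>)\<close>, hence is at most their sum.\<close>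

lemma mgf_exists_near_0_integrable_exp_abs:
  assumes "mgf_exists_near_0 M Y" and [measurable]: "Y \<in> borel_measurable M"
  shows "\<forall>\<^sub>F s in nhds 0. integrable M (\<lambda>\<omega>. exp (s * \<bar>Y \<omega>\<bar>))"
proof -
  obtain d where d: "d > 0" "\<And>s. \<bar>s\<bar> < d \<Longrightarrow> integrable M (\<lambda>\<omega>. exp (s * Y \<omega>))"
    using assms(1) unfolding mgf_exists_near_0_def by blast
  have "integrable M (\<lambda>\<omega>. exp (s * \<bar>Y \<omega>\<bar>))" if "dist s 0 < d" for s
  proof (rule Bochner_Integration.integrable_bound)
    show "integrable M (\<lambda>\<omega>. exp (s * Y \<omega>) + exp (- s * Y \<omega>))"
      using that by (intro Bochner_Integration.integrable_add d) auto
    show "AE \<omega> in M. norm (exp (s * \<bar>Y \<omega>\<bar>)) \<le> norm (exp (s * Y \<omega>) + exp (- s * Y \<omega>))"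
    proof (rule AE_I2)
      fix \<omega>
      show "norm (exp (s * \<bar>Y \<omega>\<bar>)) \<le> norm (exp (s * Y \<omega>) + exp (- s * Y \<omega>))"
        using exp_ge_zero[of "s * Y \<omega>"] exp_ge_zero[of "- s * Y \<omega>"]
        by (simp add: abs_if del: exp_ge_zero)
    qed
  qed simp
  then show ?thesis
    using d(1) unfolding eventually_nhds_metric by blast
qed

lemma integrable_dominating_degenerate_exp:
  assumes "mgf_exists_near_0 M Y" "Y \<in> borel_measurable M"
  shows "\<forall>\<^sub>F t in nhds 0. integrable M (\<lambda>\<omega>. degenerate_exp (- \<bar>lam\<bar>) \<bar>Y \<omega>\<bar> \<bar>t\<bar>)"
proof -
  \<comment> \<open>This quotient is the parameter \<open>s\<close> for which the dominating
    function equals \<open>exp (s * \<bar>Y \<omega>\<bar>)\<close>; its limit is 0 because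
    \<open>ln 1 = 0\<close>.\<close>
  have "((\<lambda>t::real. ln (1 + - \<bar>lam\<bar> * \<bar>t\<bar>) / - \<bar>lam\<bar>) \<longlongrightarrow> ln (1 + - \<bar>lam\<bar> * \<bar>0\<bar>) / - \<bar>lam\<bar>) (nhds 0)"
    unfolding divide_inverse by (intro tendsto_intros filterlim_ident) auto
  then have "filterlim (\<lambda>t. ln (1 + - \<bar>lam\<bar> * \<bar>t\<bar>) / - \<bar>lam\<bar>) (nhds 0) (nhds 0)"
    by simp
  then have "\<forall>\<^sub>F t in nhds 0. integrable M (\<lambda>\<omega>. exp (ln (1 + - \<bar>lam\<bar> * \<bar>t\<bar>) / - \<bar>lam\<bar> * \<bar>Y \<omega>\<bar>))"
    using mgf_exists_near_0_integrable_exp_abs[OF assms] by (rule filterlim_iff[THEN iffD1, rule_format])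
  moreover have "((\<lambda>t::real. 1 + - \<bar>lam\<bar> * \<bar>t\<bar>) \<longlongrightarrow> 1 + - \<bar>lam\<bar> * \<bar>0\<bar>) (nhds 0)"
    by (intro tendsto_intros filterlim_ident)
  then have "\<forall>\<^sub>F t in nhds 0. 1 + - \<bar>lam\<bar> * \<bar>t\<bar> > 0"
    by (rule order_tendstoD) simp
  ultimately show ?thesis
    by eventually_elim (simp add: degenerate_exp_eq_exp)
qed

lemma eventually_abs_mult_less_1: "\<forall>\<^sub>F t :: real in nhds 0. \<bar>lam * t\<bar> < 1"
proof -
  have "((\<lambda>t. \<bar>lam * t\<bar>) \<longlongrightarrow> \<bar>lam * 0\<bar>) (nhds 0)"
    by (intro tendsto_intros filterlim_ident)
  then show ?thesis
    by (rule order_tendstoD) simp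
qed

section \<open>Expectations as power series, and the effect of independence\<close>

text \<open>Sum and expectation may be interchanged because the integrals of the absolute values of
  the terms are summable.\<close>

lemma integral_degenerate_exp_sums:
  assumes "lam \<noteq> 0" "\<bar>lam * t\<bar> < 1" and [measurable]: "Y \<in> borel_measurable M"
    and int: "integrable M (\<lambda>\<omega>. degenerate_exp (- \<bar>lam\<bar>) \<bar>Y \<omega>\<bar> \<bar>t\<bar>)"
  shows "integrable M (\<lambda>\<omega>. degenerate_exp lam (Y \<omega>) t)"
    and "(\<lambda>n. (\<integral>\<omega>. degenerate_falling lam (Y \<omega>) n \<partial>M) * t ^ n / fact n)
           sums (\<integral>\<omega>. degenerate_exp lam (Y \<omega>) t \<partial>M)"
proof -
  define f where "f = (\<lambda>n \<omega>. degenerate_falling lam (Y \<omega>) n * t ^ n / fact n)"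
  define g where "g = (\<lambda>n \<omega>. degenerate_falling (- \<bar>lam\<bar>) \<bar>Y \<omega>\<bar> n * \<bar>t\<bar> ^ n / fact n)"
  have [measurable]: "f n \<in> borel_measurable M" for n
    unfolding f_def by measurable
  have f_le_g: "norm (f n \<omega>) \<le> g n \<omega>" for n \<omega>
    unfolding f_def g_def
    by (auto simp: abs_mult power_abs intro!: divide_right_mono mult_right_mono abs_degenerate_falling_le)
  have f_sums: "(\<lambda>n. f n \<omega>) sums degenerate_exp lam (Y \<omega>) t" for \<omega>
    unfolding f_def using assms by (intro degenerate_exp_sums)
  have g_sums: "(\<lambda>n. g n \<omega>) sums degenerate_exp (- \<bar>lam\<bar>) \<bar>Y \<omega>\<bar> \<bar>t\<bar>" for \<omega>
    unfolding g_def using assms by (intro degenerate_exp_sums) (auto simp: abs_mult)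
  \<comment> \<open>Stated for arbitrary finite \<open>N\<close>: singletons give integrability of
    each term, initial segments bound the partial sums of the integrated norms.\<close>
  have sum_le: "(\<Sum>n\<in>N. norm (f n \<omega>)) \<le> degenerate_exp (- \<bar>lam\<bar>) \<bar>Y \<omega>\<bar> \<bar>t\<bar>" if "finite N" for N \<omega>
  proof -
    have "(\<Sum>n\<in>N. norm (f n \<omega>)) \<le> (\<Sum>n\<in>N. g n \<omega>)"
      by (intro sum_mono f_le_g)
    also have "\<dots> \<le> (\<Sum>n. g n \<omega>)"
      using g_sums[of \<omega>] that order_trans[OF norm_ge_zero f_le_g]
      by (intro sum_le_suminf) (auto simp: sums_iff)
    finally show ?thesis
      using g_sums[of \<omega>] by (simp add: sums_iff)
  qed
  have int_f: "integrable M (f n)" for n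
    by (rule Bochner_Integration.integrable_bound[OF int])
      (use sum_le[of "{n}"] in \<open>auto intro: order_trans[OF _ abs_ge_self]\<close>)
  have summable_f: "AE \<omega> in M. summable (\<lambda>n. norm (f n \<omega>))"
    using f_le_g by (intro AE_I2) (rule summable_comparison_test'[OF sums_summable[OF g_sums]], simp)
  have summable_int: "summable (\<lambda>n. \<integral>\<omega>. norm (f n \<omega>) \<partial>M)"
  proof (rule summableI_nonneg_bounded)
    fix N
    have "(\<Sum>n<N. \<integral>\<omega>. norm (f n \<omega>) \<partial>M) = (\<integral>\<omega>. (\<Sum>n<N. norm (f n \<omega>)) \<partial>M)"
      using int_f by (intro Bochner_Integration.integral_sum[symmetric]) auto
    also have "\<dots> \<le> (\<integral>\<omega>. degenerate_exp (- \<bar>lam\<bar>) \<bar>Y \<omega>\<bar> \<bar>t\<bar> \<partial>M)"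
      using int_f int by (intro integral_mono sum_le Bochner_Integration.integrable_sum) auto
    finally show "(\<Sum>n<N. \<integral>\<omega>. norm (f n \<omega>) \<partial>M) \<le> \<dots>" .
  qed simp
  have suminf_f: "(\<lambda>\<omega>. \<Sum>n. f n \<omega>) = (\<lambda>\<omega>. degenerate_exp lam (Y \<omega>) t)"
    using f_sums by (simp add: sums_iff)
  show "integrable M (\<lambda>\<omega>. degenerate_exp lam (Y \<omega>) t)"
    using integrable_suminf[OF int_f summable_f summable_int] by (simp add: suminf_f)
  show "(\<lambda>n. (\<integral>\<omega>. degenerate_falling lam (Y \<omega>) n \<partial>M) * t ^ n / fact n)
          sums (\<integral>\<omega>. degenerate_exp lam (Y \<omega>) t \<partial>M)"
    using sums_integral[OF int_f summable_f summable_int] unfolding suminf_f by (simp add: f_def)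
qed

lemma eventually_integrable_degenerate_exp:
  assumes "lam \<noteq> 0" "Y \<in> borel_measurable M" "mgf_exists_near_0 M Y"
  shows "\<forall>\<^sub>F t in nhds 0. integrable M (\<lambda>\<omega>. degenerate_exp lam (Y \<omega>) t)"
  using eventually_abs_mult_less_1[of lam] integrable_dominating_degenerate_exp[OF assms(3,2), of lam]
  by eventually_elim (use assms integral_degenerate_exp_sums(1) in blast)

lemma integral_degenerate_exp_has_fps_expansion:
  assumes "lam \<noteq> 0" "Y \<in> borel_measurable M" "mgf_exists_near_0 M Y"
  shows "(\<lambda>t. \<integral>\<omega>. degenerate_exp lam (Y \<omega>) t \<partial>M) has_fps_expansion
           Abs_fps (\<lambda>n. (\<integral>\<omega>. degenerate_falling lam (Y \<omega>) n \<partial>M) / fact n)"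
proof (rule has_fps_expansionI)
  show "\<forall>\<^sub>F t in nhds 0.
          (\<lambda>n. fps_nth (Abs_fps (\<lambda>n. (\<integral>\<omega>. degenerate_falling lam (Y \<omega>) n \<partial>M) / fact n)) n * t ^ n)
            sums (\<integral>\<omega>. degenerate_exp lam (Y \<omega>) t \<partial>M)"
    using eventually_abs_mult_less_1[of lam]
      integrable_dominating_degenerate_exp[OF assms(3,2), of lam]
    by eventually_elim (use assms in \<open>simp add: integral_degenerate_exp_sums(2)\<close>)
qed

text \<open>The degenerate exponential of a sum is a product, whose expectation factors by
  independence; equal distributions make all factors equal.\<close>

lemma integral_degenerate_exp_partial_sum:
  assumes "prob_space M" "independent_copies M Y Ys"
    and Y [measurable]: "Y \<in> borel_measurable M"
    and pos: "1 + lam * t > 0" and int: "integrable M (\<lambda>\<omega>. degenerate_exp lam (Y \<omega>) t)"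
  shows "(\<integral>\<omega>. degenerate_exp lam (partial_sum Ys r \<omega>) t \<partial>M) =
           (\<integral>\<omega>. degenerate_exp lam (Y \<omega>) t \<partial>M) ^ r"
proof -
  interpret prob_space M by fact
  have indep: "indep_vars (\<lambda>_. borel) Ys {1..}"
    and distr: "\<And>j. j \<ge> 1 \<Longrightarrow> distr M borel (Ys j) = distr M borel Y"
    using assms(2) by (auto simp: independent_copies_def)
  have Ys: "Ys j \<in> borel_measurable M" if "j \<ge> 1" for j
    using indep that by (auto simp: indep_vars_def)
  have int_j: "integrable M (\<lambda>\<omega>. degenerate_exp lam (Ys j \<omega>) t)"
    and eq_j: "(\<integral>\<omega>. degenerate_exp lam (Ys j \<omega>) t \<partial>M) = (\<integral>\<omega>. degenerate_exp lam (Y \<omega>) t \<partial>M)"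
    if "j \<ge> 1" for j
    \<comment> \<open>Both integrals are rewritten over the common image measure on the
      reals.\<close>
    using int distr[OF that]
      integrable_distr_eq[OF Ys[OF that] borel_measurable_degenerate_exp, of lam t]
      integrable_distr_eq[OF Y borel_measurable_degenerate_exp, of lam t]
      integral_distr[OF Ys[OF that] borel_measurable_degenerate_exp, of lam t]
      integral_distr[OF Y borel_measurable_degenerate_exp, of lam t]
    by simp_all
  have "indep_vars (\<lambda>_. borel) (\<lambda>j \<omega>. degenerate_exp lam (Ys j \<omega>) t) {1..r}"
    by (rule indep_vars_compose2[OF indep_vars_subset[OF indep]]) auto
  then have "(\<integral>\<omega>. (\<Prod>j=1..r. degenerate_exp lam (Ys j \<omega>) t) \<partial>M) =
      (\<Prod>j=1..r. \<integral>\<omega>. degenerate_exp lam (Ys j \<omega>) t \<partial>M)"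
    using int_j by (intro indep_vars_lebesgue_integral) auto
  also have "\<dots> = (\<integral>\<omega>. degenerate_exp lam (Y \<omega>) t \<partial>M) ^ r"
    using eq_j by simp
  finally show ?thesis
    by (simp add: partial_sum_def degenerate_exp_sum[OF pos])
qed

section \<open>Binomial expansion and comparison of coefficients\<close>

theorem theorem2p3:
  fixes M :: "'a measure" and lam :: real
    and Y :: "'a \<Rightarrow> real" and Ys :: "nat \<Rightarrow> 'a \<Rightarrow> real"
    and n k r :: nat
  assumes "prob_space M"
    and "lam \<noteq> 0"
    and "Y \<in> borel_measurable M"
    and "mgf_exists_near_0 M Y"
    and "independent_copies M Y Ys"
    and "k \<le> n"
  shows "prob_degenerate_r_stirling2 M lam Y Ys r (n + r) (k + r) =
    (\<Sum>m = 0..n - k. real ((m + k) choose m) * real (r choose m) * fact m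
       * prob_degenerate_stirling2 M lam Y n (m + k))"
proof -
  interpret prob_space M by fact
  define f where "f t = (\<integral>\<omega>. degenerate_exp lam (Y \<omega>) t \<partial>M)" for t
  define G where "G = Abs_fps (\<lambda>n. (\<integral>\<omega>. degenerate_falling lam (Y \<omega>) n \<partial>M) / fact n) - 1"
  have G: "(\<lambda>t. f t - 1) has_fps_expansion G"
    unfolding f_def G_def using assms
    by (intro has_fps_expansion_diff integral_degenerate_exp_has_fps_expansion has_fps_expansion_1)
  \<comment> \<open>The constant term of the series of \<open>f\<close> is the expectation of the
    empty product, which is 1 in a probability space.\<close>
  have "fps_nth G 0 = 0"
    by (simp add: G_def degenerate_falling_def prob_space)
  then have G_power: "fps_nth (G ^ j) i = 0" if "i < j" for i j
    using startsby_zero_power_prefix that by blast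
  have stirling: "prob_degenerate_stirling2 M lam Y n j = fact n * (fps_nth (G ^ j) n / fact j)" for j
  proof -
    have "(\<lambda>t. 1 / fact j * (f t - 1) ^ j) has_fps_expansion fps_const (1 / fact j) * G ^ j"
      by (intro fps_expansion_intros G)
    then show ?thesis
      unfolding prob_degenerate_stirling2_def f_def[symmetric]
      by (subst the_has_egf_from) (auto simp: G_power)
  qed
  \<comment> \<open>\<open>G + 1\<close> is the series of \<open>f\<close>, so \<open>H\<close> is
    the candidate expansion of the generating function of the r-Stirling numbers.\<close>
  define H where "H = fps_const (1 / fact k) * G ^ k * (G + 1) ^ r"
  have H: "H = (\<Sum>m\<le>r. fps_const (real (r choose m) / fact k) * G ^ (m + k))"
    unfolding H_def binomial_ring
    by (simp add: sum_distrib_left power_add fps_of_nat[symmetric] divide_inverse algebra_simps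
        flip: fps_const_mult)
  have r_egf: "(\<lambda>t. 1 / fact k * (f t - 1) ^ k * (\<integral>\<omega>. degenerate_exp lam (partial_sum Ys r \<omega>) t \<partial>M))
      has_fps_expansion H"
  proof -
    have "(\<lambda>t. 1 / fact k * (f t - 1) ^ k * ((f t - 1) + 1) ^ r) has_fps_expansion H"
      unfolding H_def by (intro fps_expansion_intros G)
    \<comment> \<open>The factorization from independence is available only for \<open>t\<close>
      near 0, which suffices for an expansion at 0.\<close>
    also have "?this \<longleftrightarrow> ?thesis"
    proof (rule has_fps_expansion_cong)
      show "\<forall>\<^sub>F t in nhds 0. 1 / fact k * (f t - 1) ^ k * ((f t - 1) + 1) ^ r =
          1 / fact k * (f t - 1) ^ k * (\<integral>\<omega>. degenerate_exp lam (partial_sum Ys r \<omega>) t \<partial>M)"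
        using eventually_abs_mult_less_1[of lam]
          eventually_integrable_degenerate_exp[OF assms(2,3,4)]
      proof eventually_elim
        case (elim t)
        then have "(\<integral>\<omega>. degenerate_exp lam (partial_sum Ys r \<omega>) t \<partial>M) = f t ^ r"
          unfolding f_def using assms by (intro integral_degenerate_exp_partial_sum) auto
        then show ?case by simp
      qed
    qed simp
    finally show ?thesis .
  qed
  have "fps_nth H i = 0" if "i < k" for i
    unfolding H using that by (auto simp: fps_sum_nth G_power intro!: sum.neutral)
  then have "prob_degenerate_r_stirling2 M lam Y Ys r (n + r) (k + r) = fact n * fps_nth H n"
    unfolding prob_degenerate_r_stirling2_def f_def[symmetric] Let_def
    using the_has_egf_from[OF r_egf] by simp
  also have "\<dots> = (\<Sum>m\<le>r. fact n * (real (r choose m) / fact k * fps_nth (G ^ (m + k)) n))"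
    by (simp add: H fps_sum_nth sum_distrib_left)
  \<comment> \<open>Terms in just one of the two ranges vanish: for \<open>m > r\<close> the
    binomial coefficient is 0, and for \<open>m > n - k\<close> the power \<open>G ^ (m + k)\<close>
    has no coefficient at \<open>n\<close>.\<close>
  also have "\<dots> = (\<Sum>m = 0..n - k. fact n * (real (r choose m) / fact k * fps_nth (G ^ (m + k)) n))"
    using G_power by (intro sum.mono_neutral_cong) (auto simp: binomial_eq_0)
  also have "\<dots> = (\<Sum>m = 0..n - k. real ((m + k) choose m) * real (r choose m) * fact m
       * prob_degenerate_stirling2 M lam Y n (m + k))"
  proof (rule sum.cong)
    fix m
    \<comment> \<open>Converts the factor \<open>1 / fact k\<close> into the normalization
      \<open>1 / fact (m + k)\<close> occurring in \<open>stirling\<close>.\<close>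
    have "real ((m + k) choose m) = fact (m + k) / (fact m * fact k)"
      by (simp add: binomial_fact)
    then show "fact n * (real (r choose m) / fact k * fps_nth (G ^ (m + k)) n) =
        real ((m + k) choose m) * real (r choose m) * fact m * prob_degenerate_stirling2 M lam Y n (m + k)"
      by (simp add: stirling)
  qed simp
  finally show ?thesis .
qed

end
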